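(* $\mathcal{E}$ is $\frac1n$-semi-concave, i.e. $Y\mapsto\mathcal{E}(Y)-\frac1n\|Y\|_F^2$ is concave on $\mathbb{R}^{n\times d}$.
   Context: Let $n,d\ge1$. A matrix $Y\in\mathbb{R}^{n\times d}$ is written $Y=(y_1,\dots,y_n)^T$ with rows $y_k\in\mathbb{R}^d$, and $\gamma_Y:=\frac1n\sum_{k=1}^n\delta_{y_k}$. Fix $Z\in\mathbb{R}^{n\times d}$. With $\sigma$ the uniform probability measure on the unit sphere $\mathbb{S}^{d-1}$, $P_\theta(x)=\theta^Tx$, $\#$ the push-forward and $\mathrm{W}_2$ the 2-Wasserstein distance, $\mathcal{E}(Y):=\int_{\mathbb{S}^{d-1}}\mathrm{W}_2^2(P_{\theta}\#\gamma_Y,P_{\theta}\#\gamma_Z)\,d\sigma(\theta)$. $\|\cdot\|_F$ is the Frobenius norm, i.e. the Euclidean norm on $\mathbb{R}^{n\times d}$. *)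

theory Defs
  imports "HOL-Probability.Probability"
begin

(* A matrix in R^(n x d) is an element of real^'d^'n, with n = CARD('n) and d = CARD('d):
   Y $ k is the k-th row, and the library norm on this type is the Frobenius norm. *)

lemma norm_eq_Frobenius:
  fixes Y :: "real^'d^'n"
  shows "norm Y = sqrt (\<Sum>k\<in>UNIV. \<Sum>i\<in>UNIV. (Y $ k $ i)\<^sup>2)"
  by (simp add: norm_vec_def L2_set_def sum_nonneg)

(* The normalised surface measure, as the law of x / |x| for x uniform in the unit ball.
   The map sgn sends 0 to 0, which is not on the sphere, but {0} is a null set. It is the
   probability measure on the sphere that is invariant under orthogonal maps, see
   prob_space_uniform_sphere and distr_uniform_sphere_orthogonal_transformation (the class
   wellorder in the latter comes from the library lemma measure_orthogonal_image). *)

definition uniform_sphere :: "'a::euclidean_space measure" where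
  "uniform_sphere =
     restrict_space (distr (uniform_measure lborel (ball 0 1)) borel sgn) (sphere 0 1)"

lemma borel_measurable_sgn_euclidean [measurable]:
  "(sgn :: 'a::euclidean_space \<Rightarrow> 'a) \<in> borel_measurable borel"
  unfolding sgn_div_norm[abs_def] by measurable

lemma prob_space_uniform_sphere: "prob_space (uniform_sphere :: 'a::euclidean_space measure)"
proof -
  let ?B = "ball (0::'a) 1"
  have pos: "emeasure lborel ?B > 0"
    by (simp add: emeasure_ball unit_ball_vol_pos)
  have fin: "emeasure lborel ?B < \<infinity>"
    by (rule emeasure_lborel_ball_finite)
  interpret U: prob_space "uniform_measure lborel ?B"
    using pos fin by (intro prob_space_uniform_measure) auto
  interpret D: prob_space "distr (uniform_measure lborel ?B) borel sgn"
    by (rule U.prob_space_distr) simp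
  have "AE x in lborel. x \<noteq> (0::'a)"
    by (rule AE_lborel_singleton)
  then have "AE x in uniform_measure lborel ?B. x \<noteq> 0"
    by (intro AE_uniform_measureI) auto
  then have "AE x in uniform_measure lborel ?B. sgn x \<in> sphere 0 1"
    by (rule eventually_mono) (simp add: norm_sgn)
  then have "AE x in distr (uniform_measure lborel ?B) borel sgn. x \<in> sphere 0 1"
    by (subst AE_distr_iff) auto
  then have "emeasure (distr (uniform_measure lborel ?B) borel sgn) (sphere 0 1) = 1"
    by (intro D.emeasure_eq_1_AE) auto
  then show ?thesis
    unfolding uniform_sphere_def
    by (intro prob_spaceI) (simp add: emeasure_restrict_space space_restrict_space)
qed

lemma distr_lborel_orthogonal_transformation:
  fixes f :: "real^'d::{finite,wellorder} \<Rightarrow> real^'d::{finite,wellorder}"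
  assumes f: "orthogonal_transformation f"
  shows "distr lborel borel f = lborel"
proof (rule sym, rule lborel_eqI)
  fix l u :: "real^'d::{finite,wellorder}" assume lu: "\<And>b. b \<in> Basis \<Longrightarrow> l \<bullet> b \<le> u \<bullet> b"
  have [measurable]: "f \<in> borel_measurable borel"
    using f by (intro borel_measurable_continuous_onI linear_continuous_on
        linear_conv_bounded_linear[THEN iffD1] orthogonal_transformation_linear)
  have g: "orthogonal_transformation (inv f)"
    by (rule orthogonal_transformation_inv[OF f])
  have im: "f -` box l u = inv f ` box l u"
    using orthogonal_transformation_bij[OF f] by (simp add: bij_vimage_eq_inv_image)
  have b: "box l u \<in> lmeasurable" by simp
  have "emeasure (distr lborel borel f) (box l u) = emeasure lborel (f -` box l u)"
    by (simp add: emeasure_distr)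
  also have "\<dots> = emeasure lebesgue (f -` box l u)"
    using measurable_sets_borel[of f borel "box l u"] by simp
  also have "\<dots> = emeasure lebesgue (box l u)"
    unfolding im using measure_orthogonal_image[OF g b] measurable_orthogonal_image[OF g b] b
    by (simp add: emeasure_eq_measure2)
  also have "\<dots> = ennreal (\<Prod>b\<in>Basis. (u - l) \<bullet> b)"
    using lu by (simp add: emeasure_lborel_box)
  finally show "emeasure (distr lborel borel f) (box l u) = ennreal (\<Prod>b\<in>Basis. (u - l) \<bullet> b)" .
qed simp

lemma distr_uniform_sphere_orthogonal_transformation:
  fixes f :: "real^'d::{finite,wellorder} \<Rightarrow> real^'d::{finite,wellorder}"
  assumes f: "orthogonal_transformation f"
  shows "distr uniform_sphere uniform_sphere f = uniform_sphere"
proof -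
  let ?B = "ball (0::real^'d::{finite,wellorder}) 1"
  let ?D = "distr (uniform_measure lborel ?B) borel sgn"
  have lin: "linear f" using f by (rule orthogonal_transformation_linear)
  have nf: "norm (f x) = norm x" for x using f by (rule orthogonal_transformation_norm)
  have [measurable]: "f \<in> borel_measurable borel"
    using lin by (intro borel_measurable_continuous_onI linear_continuous_on
        linear_conv_bounded_linear[THEN iffD1])
  have sf: "sgn (f x) = f (sgn x)" for x
    by (simp add: sgn_div_norm nf linear_cmul[OF lin])
  have inv: "emeasure ?D (f -` A) = emeasure ?D A" if [measurable]: "A \<in> sets borel" for A
  proof -
    have "emeasure lborel (?B \<inter> sgn -` f -` A) = emeasure lborel (f -` (?B \<inter> sgn -` A))"
      by (rule arg_cong[where f = "emeasure lborel"]) (auto simp: sf nf)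
    also have "\<dots> = emeasure (distr lborel borel f) (?B \<inter> sgn -` A)"
      using measurable_sets_borel[OF borel_measurable_sgn_euclidean that]
      by (subst emeasure_distr) auto
    also have "\<dots> = emeasure lborel (?B \<inter> sgn -` A)"
      by (simp add: distr_lborel_orthogonal_transformation[OF f])
    finally show ?thesis
      using measurable_sets_borel[of f borel A]
        measurable_sets_borel[OF borel_measurable_sgn_euclidean that]
        measurable_sets_borel[OF borel_measurable_sgn_euclidean, of "f -` A"]
      by (simp add: emeasure_distr)
  qed
  have meas: "f \<in> measurable uniform_sphere uniform_sphere"
    unfolding uniform_sphere_def
    by (intro measurable_restrict_space3) (auto simp: nf)
  show ?thesis
  proof (rule measure_eqI)
    fix A assume "A \<in> sets (distr uniform_sphere uniform_sphere f)"
    then have A: "A \<in> sets uniform_sphere" by simp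
    then have A': "A \<subseteq> sphere 0 1" "A \<in> sets borel"
      by (auto simp: uniform_sphere_def sets_restrict_space_iff)
    have sub: "f -` A \<subseteq> sphere 0 1" using A'(1) by (auto simp: nf subset_iff)
    have "emeasure (distr uniform_sphere uniform_sphere f) A = emeasure uniform_sphere (f -` A)"
      unfolding emeasure_distr[OF meas A]
      using sub by (simp add: uniform_sphere_def space_restrict_space Int_absorb2)
    also have "\<dots> = emeasure ?D (f -` A)"
      unfolding uniform_sphere_def using sub by (simp add: emeasure_restrict_space)
    also have "\<dots> = emeasure ?D A" by (rule inv[OF A'(2)])
    also have "\<dots> = emeasure uniform_sphere A"
      unfolding uniform_sphere_def using A' by (simp add: emeasure_restrict_space)
    finally show "emeasure (distr uniform_sphere uniform_sphere f) A = emeasure uniform_sphere A" .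
  qed simp
qed

definition couplings :: "'a::topological_space measure \<Rightarrow> 'a measure \<Rightarrow> ('a \<times> 'a) measure set" where
  "couplings \<mu> \<nu> = {\<pi>. sets \<pi> = sets (borel \<Otimes>\<^sub>M borel) \<and>
                       distr \<pi> borel fst = \<mu> \<and> distr \<pi> borel snd = \<nu>}"

(* Intended for Borel probability measures with finite second moments: there the infimum of the
   transport costs is finite, so that enn2real (which maps infinity to 0) is harmless. *)

definition wasserstein2 :: "'a::{metric_space, second_countable_topology} measure \<Rightarrow> 'a measure \<Rightarrow> real" where
  "wasserstein2 \<mu> \<nu> =
     sqrt (enn2real (INF \<pi>\<in>couplings \<mu> \<nu>. \<integral>\<^sup>+ (x, y). ennreal ((dist x y)\<^sup>2) \<partial>\<pi>))"

(* The push-forward of the normalised counting measure on the row indices under the map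
   sending k to the k-th row; the lemma below shows that this is (1/n) times the sum of the
   Dirac measures at the rows. *)

definition empirical_measure :: "'a::topological_space^'n \<Rightarrow> 'a measure" where
  "empirical_measure Y = distr (uniform_count_measure UNIV) borel (\<lambda>k. Y $ k)"

lemma emeasure_empirical_measure:
  fixes Y :: "'a::topological_space^'n"
  assumes "A \<in> sets borel"
  shows "emeasure (empirical_measure Y) A =
    ennreal (1 / real CARD('n)) * (\<Sum>k\<in>UNIV. emeasure (return borel (Y $ k)) A)"
proof -
  have "(\<Sum>k\<in>UNIV. emeasure (return borel (Y $ k)) A) = of_nat (card ((\<lambda>k. Y $ k) -` A))"
    using assms by (simp add: indicator_def[abs_def] vimage_def sum.If_cases)
  moreover have "emeasure (empirical_measure Y) A =
      ennreal (real (card ((\<lambda>k. Y $ k) -` A)) / real CARD('n))"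
    using assms unfolding empirical_measure_def
    by (subst emeasure_distr)
      (auto simp: measurable_def space_uniform_count_measure sets_uniform_count_measure
        emeasure_uniform_count_measure)
  ultimately show ?thesis
    by (simp add: ennreal_of_nat_eq_real_of_nat flip: ennreal_mult)
qed

definition sliced_energy :: "real^'d^'n \<Rightarrow> real^'d^'n \<Rightarrow> real" where
  "sliced_energy Z Y =
     (\<integral>\<theta>. (wasserstein2 (distr (empirical_measure Y) borel (\<lambda>x. \<theta> \<bullet> x))
                        (distr (empirical_measure Z) borel (\<lambda>x. \<theta> \<bullet> x)))\<^sup>2 \<partial>uniform_sphere)"

end

theory Submission
  imports Defs
begin

text \<open>
  Couplings of two empirical measures have the same transport costs as matrices \<open>w\<close> of weights on
  pairs of row indices with uniform marginals, so the squared Wasserstein distance is the infimum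
  over \<open>w\<close> of the costs \<open>\<Sum>k l. w k l * (dist (y\<^sub>k) (z\<^sub>l))\<^sup>2\<close>. The set of plans \<open>w\<close> does not depend on
  \<open>y\<close>, and for each \<open>w\<close> the quadratic part of the cost in \<open>y\<close> is \<open>norm y ^ 2 / n\<close>, because the row
  sums of \<open>w\<close> are \<open>1/n\<close>. Since projecting onto a unit vector \<open>\<theta>\<close> is a contraction, each projected
  cost minus \<open>norm Y ^ 2 / n\<close> is concave in \<open>Y\<close>. This survives the infimum over \<open>w\<close> and the average
  over \<open>\<theta>\<close>.
\<close>

section \<open>Transport plans between row indices and their costs\<close>

definition uniform_plans :: "('m::finite \<Rightarrow> 'n::finite \<Rightarrow> real) set" where
  "uniform_plans = {w. (\<forall>k l. 0 \<le> w k l) \<and> (\<forall>k. (\<Sum>l\<in>UNIV. w k l) = 1 / real CARD('m)) \<and>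
                       (\<forall>l. (\<Sum>k\<in>UNIV. w k l) = 1 / real CARD('n))}"

definition plan_cost :: "('m::finite \<Rightarrow> 'n::finite \<Rightarrow> real) \<Rightarrow> 'a::metric_space^'m \<Rightarrow> 'a^'n \<Rightarrow> real" where
  "plan_cost w y z = (\<Sum>k\<in>UNIV. \<Sum>l\<in>UNIV. w k l * (dist (y $ k) (z $ l))\<^sup>2)"

lemma plan_cost_nonneg: "w \<in> uniform_plans \<Longrightarrow> 0 \<le> plan_cost w y z"
  unfolding plan_cost_def uniform_plans_def by (auto intro!: sum_nonneg)

text \<open>This is the product coupling of the two uniform distributions. It shows that the infima
  over plans range over a nonempty set, and it serves later as an explicit competitor.\<close>

lemma const_mem_uniform_plans:
  "(\<lambda>k l. 1 / (real CARD('m) * real CARD('n))) \<in> (uniform_plans :: ('m::finite \<Rightarrow> 'n::finite \<Rightarrow> real) set)"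
  unfolding uniform_plans_def by auto

lemma uniform_plans_nonempty: "uniform_plans \<noteq> {}"
  using const_mem_uniform_plans by blast

lemma bdd_below_plan_cost: "bdd_below ((\<lambda>w. plan_cost w y z) ` uniform_plans)"
  using plan_cost_nonneg by (intro bdd_belowI[of _ 0]) auto

section \<open>From couplings of empirical measures to plans and back\<close>

lemma prob_space_empirical_measure: "prob_space (empirical_measure Y)"
  unfolding empirical_measure_def
  by (intro prob_space.prob_space_distr prob_space_uniform_count_measure)
    (auto simp: measurable_def space_uniform_count_measure sets_uniform_count_measure)

lemma measure_empirical_measure:
  fixes Y :: "'a::topological_space^'n"
  assumes "A \<in> sets borel"
  shows "measure (empirical_measure Y) A = card {k. Y $ k \<in> A} / real CARD('n)"
proof -
  have "emeasure (empirical_measure Y) A = ennreal (card {k. Y $ k \<in> A} / real CARD('n))"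
    using assms unfolding empirical_measure_def
    by (subst emeasure_distr)
      (auto simp: measurable_def space_uniform_count_measure sets_uniform_count_measure
        emeasure_uniform_count_measure vimage_def)
  then show ?thesis by (simp add: measure_def)
qed

text \<open>All indices in one fibre of \<open>f\<close> carry equal shares of the value at their
  common image. This turns sums over distinct atoms into sums over indices, also when rows
  coincide.\<close>

lemma sum_over_fibres:
  fixes g :: "'b \<Rightarrow> real" and f :: "'i::finite \<Rightarrow> 'b"
  shows "(\<Sum>k\<in>UNIV. g (f k) / card {i. f i = f k}) = sum g (range f)"
proof -
  have "(\<Sum>k\<in>UNIV. g (f k) / card {i. f i = f k}) =
      (\<Sum>y\<in>range f. \<Sum>k\<in>{k. k \<in> UNIV \<and> f k = y}. g (f k) / card {i. f i = f k})"
    by (rule sum.image_gen) simp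
  also have "\<dots> = (\<Sum>y\<in>range f. \<Sum>k\<in>{k. f k = y}. g y / card {i. f i = y})"
    by (intro sum.cong) auto
  also have "\<dots> = sum g (range f)"
    by (intro sum.cong) (auto simp: card_gt_0_iff)
  finally show ?thesis .
qed

text \<open>The marginals force \<open>\<pi>\<close> onto the finite grid of pairs of a row of
  \<open>y\<close> and a row of \<open>z\<close>, so \<open>\<pi>\<close> is determined by the
  masses of finitely many atoms.\<close>

lemma uniform_plan_of_coupling:
  fixes y :: "'a::{metric_space, second_countable_topology}^'m" and z :: "'a^'n"
  assumes "\<pi> \<in> couplings (empirical_measure y) (empirical_measure z)"
  obtains w where "w \<in> uniform_plans"
    "(\<integral>\<^sup>+ (a, b). ennreal ((dist a b)\<^sup>2) \<partial>\<pi>) = ennreal (plan_cost w y z)"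
proof -
  have sets_pi: "sets \<pi> = sets (borel \<Otimes>\<^sub>M borel)"
    and fst_pi: "distr \<pi> borel fst = empirical_measure y"
    and snd_pi: "distr \<pi> borel snd = empirical_measure z"
    using assms by (auto simp: couplings_def)
  note [measurable_cong] = sets_pi
  have space_pi: "space \<pi> = UNIV"
    using sets_eq_imp_space_eq[OF sets_pi] by (simp add: space_pair_measure)
  \<comment> \<open>Total mass 1 is inherited from the first marginal.\<close>
  have prob_pi: "prob_space \<pi>"
    using prob_space_empirical_measure[of y] unfolding fst_pi[symmetric]
    by (rule prob_space_distrD[rotated]) measurable
  interpret prob_space \<pi> by (rule prob_pi)
  let ?R = "range (($) y)" and ?S = "range (($) z)"
  have fin: "finite ?R" "finite ?S" by auto
  have [measurable]: "?R \<in> sets borel" "?S \<in> sets borel"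
    by (intro borel_closed finite_imp_closed fin)+
  have m_fst: "prob (fst -` A) = card {k. y $ k \<in> A} / real CARD('m)" if "A \<in> sets borel" for A
    using that by (subst measure_empirical_measure[symmetric, OF that], subst fst_pi[symmetric],
        subst measure_distr) (auto simp: space_pi)
  have m_snd: "prob (snd -` A) = card {k. z $ k \<in> A} / real CARD('n)" if "A \<in> sets borel" for A
    using that by (subst measure_empirical_measure[symmetric, OF that], subst snd_pi[symmetric],
        subst measure_distr) (auto simp: space_pi)
  have "AE p in \<pi>. p \<in> fst -` ?R"
    using m_fst[of ?R] measurable_sets[of fst \<pi> borel ?R]
    by (intro AE_prob_1) (simp add: space_pi)
  moreover have "AE p in \<pi>. p \<in> snd -` ?S"
    using m_snd[of ?S] by (intro AE_prob_1) simp
  ultimately have AE_RS: "AE p in \<pi>. fst p \<in> ?R \<and> snd p \<in> ?S" by eventually_elim auto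
  have sing [measurable]: "{p} \<in> sets \<pi>" for p
  proof -
    have "{p} = {fst p} \<times> {snd p}" by auto
    also have "\<dots> \<in> sets \<pi>" by (subst sets_pi, intro pair_measureI) auto
    finally show ?thesis .
  qed
  define r where "r a = real (card {k. y $ k = a})" for a
  define s where "s b = real (card {l. z $ l = b})" for b
  txt \<open>Rows may coincide, so the mass of an atom is shared equally among the indices that give it.\<close>
  define w where "w k l = prob {(y $ k, z $ l)} / s (z $ l) / r (y $ k)" for k l
  have r_pos: "r (y $ k) > 0" for k unfolding r_def by (auto simp: card_gt_0_iff)
  have s_pos: "s (z $ l) > 0" for l unfolding s_def by (auto simp: card_gt_0_iff)
  have w_nonneg: "w k l \<ge> 0" for k l
    using r_pos[of k] s_pos[of l] by (simp add: w_def)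
  have row: "(\<Sum>l\<in>UNIV. w k l) = 1 / real CARD('m)" for k
  proof -
    have "(\<Sum>l\<in>UNIV. w k l) = (\<Sum>l\<in>UNIV. prob {(y $ k, z $ l)} / s (z $ l)) / r (y $ k)"
      by (simp add: w_def sum_divide_distrib)
    also have "(\<Sum>l\<in>UNIV. prob {(y $ k, z $ l)} / s (z $ l)) = (\<Sum>b\<in>?S. prob {(y $ k, b)})"
      using sum_over_fibres[of "\<lambda>b. prob {(y $ k, b)}" "($) z"] unfolding s_def .
    also have "\<dots> = prob (\<Union>b\<in>?S. {(y $ k, b)})"
      by (intro finite_measure_finite_Union[symmetric]) (auto simp: disjoint_family_on_def)
    also have "\<dots> = prob (fst -` {y $ k})"
    \<comment> \<open>The fibre over \<open>y $ k\<close> may also contain points whose second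
      coordinate is not a row of \<open>z\<close>; these form a null set.\<close>
    proof (rule measure_eq_AE)
      show "AE p in \<pi>. p \<in> (\<Union>b\<in>?S. {(y $ k, b)}) \<longleftrightarrow> p \<in> fst -` {y $ k}"
        using AE_RS by eventually_elim (auto simp: prod_eq_iff)
      show "fst -` {y $ k} \<in> events"
        using measurable_sets[of fst \<pi> borel "{y $ k}"] by (simp add: space_pi)
    qed (intro sets.finite_UN fin sing)
    also have "\<dots> = r (y $ k) / real CARD('m)" by (subst m_fst) (auto simp: r_def)
    finally show ?thesis using r_pos[of k] by simp
  qed
  have col: "(\<Sum>k\<in>UNIV. w k l) = 1 / real CARD('n)" for l
  proof -
    have "(\<Sum>k\<in>UNIV. w k l) = (\<Sum>k\<in>UNIV. prob {(y $ k, z $ l)} / r (y $ k)) / s (z $ l)"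
      by (simp add: w_def sum_divide_distrib mult.commute)
    also have "(\<Sum>k\<in>UNIV. prob {(y $ k, z $ l)} / r (y $ k)) = (\<Sum>a\<in>?R. prob {(a, z $ l)})"
      using sum_over_fibres[of "\<lambda>a. prob {(a, z $ l)}" "($) y"] unfolding r_def .
    also have "\<dots> = prob (\<Union>a\<in>?R. {(a, z $ l)})"
      by (intro finite_measure_finite_Union[symmetric]) (auto simp: disjoint_family_on_def)
    also have "\<dots> = prob (snd -` {z $ l})"
    proof (rule measure_eq_AE)
      show "AE p in \<pi>. p \<in> (\<Union>a\<in>?R. {(a, z $ l)}) \<longleftrightarrow> p \<in> snd -` {z $ l}"
        using AE_RS by eventually_elim (auto simp: prod_eq_iff)
      show "snd -` {z $ l} \<in> events"
        using measurable_sets[of snd \<pi> borel "{z $ l}"] by (simp add: space_pi)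
    qed (intro sets.finite_UN fin sing)
    also have "\<dots> = s (z $ l) / real CARD('n)" by (subst m_snd) (auto simp: s_def)
    finally show ?thesis using s_pos[of l] by simp
  qed
  \<comment> \<open>Almost everywhere the cost function equals a finite combination of indicators of
    grid points, which reduces the integral to a sum over atoms.\<close>
  have "(\<integral>\<^sup>+ (a, b). ennreal ((dist a b)\<^sup>2) \<partial>\<pi>) =
      (\<integral>\<^sup>+ p. (\<Sum>q\<in>?R \<times> ?S. ennreal ((dist (fst q) (snd q))\<^sup>2) * indicator {q} p) \<partial>\<pi>)"
  proof (rule nn_integral_cong_AE, use AE_RS in eventually_elim)
    case (elim p)
    then have "(\<Sum>q\<in>?R \<times> ?S. ennreal ((dist (fst q) (snd q))\<^sup>2) * indicator {q} p) =
        (\<Sum>q\<in>{p}. ennreal ((dist (fst q) (snd q))\<^sup>2) * indicator {q} p)"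
      by (intro sum.mono_neutral_right) (auto simp: mem_Times_iff)
    then show ?case by (simp add: case_prod_beta)
  qed
  also have "\<dots> = (\<Sum>q\<in>?R \<times> ?S. ennreal ((dist (fst q) (snd q))\<^sup>2) * emeasure \<pi> {q})"
    by (subst nn_integral_sum) (auto simp: nn_integral_cmult_indicator)
  also have "\<dots> = (\<Sum>q\<in>?R \<times> ?S. ennreal ((dist (fst q) (snd q))\<^sup>2 * prob {q}))"
    by (simp add: emeasure_eq_measure ennreal_mult)
  also have "\<dots> = ennreal (\<Sum>q\<in>?R \<times> ?S. (dist (fst q) (snd q))\<^sup>2 * prob {q})"
    by (rule sum_ennreal) simp
  also have "(\<Sum>q\<in>?R \<times> ?S. (dist (fst q) (snd q))\<^sup>2 * prob {q}) =
      (\<Sum>a\<in>?R. \<Sum>b\<in>?S. (dist a b)\<^sup>2 * prob {(a, b)})"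
    by (simp add: sum.cartesian_product case_prod_beta)
  \<comment> \<open>The atoms are now redistributed to indices, first in the rows of
    \<open>y\<close>, then in those of \<open>z\<close>; the divisors are the ones in the definition
    of \<open>w\<close>.\<close>
  also have "\<dots> = (\<Sum>k\<in>UNIV. (\<Sum>b\<in>?S. (dist (y $ k) b)\<^sup>2 * prob {(y $ k, b)}) / r (y $ k))"
    using sum_over_fibres[of "\<lambda>a. \<Sum>b\<in>?S. (dist a b)\<^sup>2 * prob {(a, b)}" "($) y"]
    unfolding r_def by simp
  also have "\<dots> = (\<Sum>k\<in>UNIV. (\<Sum>l\<in>UNIV. (dist (y $ k) (z $ l))\<^sup>2 * prob {(y $ k, z $ l)} / s (z $ l))
      / r (y $ k))"
    using sum_over_fibres[of "\<lambda>b. (dist (y $ k) b)\<^sup>2 * prob {(y $ k, b)}" "($) z" for k]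
    unfolding s_def by simp
  also have "\<dots> = plan_cost w y z"
    unfolding plan_cost_def w_def by (simp add: sum_divide_distrib mult.commute)
  finally show ?thesis
    using w_nonneg row col by (intro that[of w]) (auto simp: uniform_plans_def)
qed

text \<open>The plan is read as a measure on pairs of indices and pushed forward along the map from
  index pairs to pairs of rows. Coinciding rows cause no trouble in this direction.\<close>

lemma coupling_of_uniform_plan:
  fixes y :: "'a::{metric_space, second_countable_topology}^'m" and z :: "'a^'n"
  assumes w: "w \<in> uniform_plans"
  obtains \<pi> where "\<pi> \<in> couplings (empirical_measure y) (empirical_measure z)"
    "(\<integral>\<^sup>+ (a, b). ennreal ((dist a b)\<^sup>2) \<partial>\<pi>) = ennreal (plan_cost w y z)"
proof
  have w_nonneg: "0 \<le> w k l" for k l using w by (auto simp: uniform_plans_def)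
  let ?P = "point_measure UNIV (\<lambda>(k, l). ennreal (w k l))"
  let ?\<pi> = "distr ?P (borel \<Otimes>\<^sub>M borel) (\<lambda>(k, l). (y $ k, z $ l))"
  have meas: "f \<in> measurable ?P N" if "range f \<subseteq> space N" for f and N :: "'b measure"
    using that by (auto simp: measurable_def space_point_measure sets_point_measure)
  \<comment> \<open>The marginal is computed on the indices, where singletons suffice; composing
    with the row map then gives the marginal of the push-forward.\<close>
  have "distr ?P (uniform_count_measure UNIV) fst = uniform_count_measure UNIV"
  proof (rule measure_eqI_finite[of _ UNIV])
    fix k :: 'm
    have "emeasure (distr ?P (uniform_count_measure UNIV) fst) {k} = emeasure ?P (fst -` {k})"
      by (subst emeasure_distr)
        (auto simp: meas space_uniform_count_measure space_point_measure sets_uniform_count_measure)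
    also have "\<dots> = (\<Sum>(k', l)\<in>{k} \<times> UNIV. ennreal (w k' l))"
      by (subst emeasure_point_measure_finite) (auto intro!: sum.cong)
    also have "\<dots> = ennreal (\<Sum>l\<in>UNIV. w k l)"
      by (simp add: sum.cartesian_product[symmetric] sum_ennreal w_nonneg)
    also have "\<dots> = emeasure (uniform_count_measure UNIV) {k}"
      using w by (simp add: uniform_plans_def emeasure_uniform_count_measure)
    finally show "emeasure (distr ?P (uniform_count_measure UNIV) fst) {k} =
      emeasure (uniform_count_measure UNIV) {k}" .
  qed (auto simp: sets_uniform_count_measure)
  then have "empirical_measure y = distr (distr ?P (uniform_count_measure UNIV) fst) borel (($) y)"
    by (simp add: empirical_measure_def)
  also have "\<dots> = distr ?P borel (\<lambda>q. y $ fst q)"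
    by (subst distr_distr)
      (auto simp: meas space_uniform_count_measure sets_uniform_count_measure
        measurable_def[of "uniform_count_measure _"] comp_def)
  also have "\<dots> = distr ?\<pi> borel fst"
    by (subst distr_distr) (auto simp: comp_def case_prod_beta meas space_pair_measure)
  finally have fst_pi: "distr ?\<pi> borel fst = empirical_measure y" ..
  have "distr ?P (uniform_count_measure UNIV) snd = uniform_count_measure UNIV"
  proof (rule measure_eqI_finite[of _ UNIV])
    fix l :: 'n
    have "emeasure (distr ?P (uniform_count_measure UNIV) snd) {l} = emeasure ?P (snd -` {l})"
      by (subst emeasure_distr)
        (auto simp: meas space_uniform_count_measure space_point_measure sets_uniform_count_measure)
    also have "\<dots> = (\<Sum>(k, l')\<in>UNIV \<times> {l}. ennreal (w k l'))"
      by (subst emeasure_point_measure_finite) (auto intro!: sum.cong)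
    also have "\<dots> = ennreal (\<Sum>k\<in>UNIV. w k l)"
      by (simp add: sum.cartesian_product[symmetric] sum_ennreal w_nonneg)
    also have "\<dots> = emeasure (uniform_count_measure UNIV) {l}"
      using w by (simp add: uniform_plans_def emeasure_uniform_count_measure)
    finally show "emeasure (distr ?P (uniform_count_measure UNIV) snd) {l} =
      emeasure (uniform_count_measure UNIV) {l}" .
  qed (auto simp: sets_uniform_count_measure)
  then have "empirical_measure z = distr (distr ?P (uniform_count_measure UNIV) snd) borel (($) z)"
    by (simp add: empirical_measure_def)
  also have "\<dots> = distr ?P borel (\<lambda>q. z $ snd q)"
    by (subst distr_distr)
      (auto simp: meas space_uniform_count_measure sets_uniform_count_measure
        measurable_def[of "uniform_count_measure _"] comp_def)
  also have "\<dots> = distr ?\<pi> borel snd"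
    by (subst distr_distr) (auto simp: comp_def case_prod_beta meas space_pair_measure)
  finally have snd_pi: "distr ?\<pi> borel snd = empirical_measure z" ..
  show "?\<pi> \<in> couplings (empirical_measure y) (empirical_measure z)"
    using fst_pi snd_pi by (simp add: couplings_def)
  have "(\<integral>\<^sup>+ (a, b). ennreal ((dist a b)\<^sup>2) \<partial>?\<pi>) =
      (\<integral>\<^sup>+ (k, l). ennreal ((dist (y $ k) (z $ l))\<^sup>2) \<partial>?P)"
    by (subst nn_integral_distr)
      (auto simp: case_prod_beta meas space_pair_measure intro!: nn_integral_cong)
  also have "\<dots> = (\<Sum>(k, l)\<in>UNIV \<times> UNIV. ennreal (w k l * (dist (y $ k) (z $ l))\<^sup>2))"
    by (subst nn_integral_point_measure_finite) (auto simp: case_prod_beta ennreal_mult w_nonneg)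
  also have "\<dots> = (\<Sum>k\<in>UNIV. \<Sum>l\<in>UNIV. ennreal (w k l * (dist (y $ k) (z $ l))\<^sup>2))"
    by (rule sum.cartesian_product[symmetric])
  also have "\<dots> = ennreal (plan_cost w y z)"
    unfolding plan_cost_def by (simp add: sum_ennreal w_nonneg sum_nonneg)
  finally show "(\<integral>\<^sup>+ (a, b). ennreal ((dist a b)\<^sup>2) \<partial>?\<pi>) = ennreal (plan_cost w y z)" .
qed

section \<open>The squared Wasserstein distance as an infimum over plans\<close>

lemma enn2real_INF_ennreal:
  fixes f :: "'i \<Rightarrow> real"
  assumes "I \<noteq> {}" and nonneg: "\<And>i. i \<in> I \<Longrightarrow> 0 \<le> f i"
  shows "enn2real (INF i\<in>I. ennreal (f i)) = (INF i\<in>I. f i)"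
proof -
  have bdd: "bdd_below (f ` I)" using nonneg by (intro bdd_belowI[of _ 0]) auto
  \<comment> \<open>A single member bounds the infimum, so \<open>enn2real\<close> does not meet
    infinity, which it would send to 0.\<close>
  have fin: "(INF i\<in>I. ennreal (f i)) < \<infinity>"
    using assms(1) by (auto simp: INF_less_iff)
  show ?thesis
  proof (rule antisym)
    show "enn2real (INF i\<in>I. ennreal (f i)) \<le> (INF i\<in>I. f i)"
      using assms by (intro cINF_greatest) (auto intro!: enn2real_leI INF_lower)
    have "ennreal (INF i\<in>I. f i) \<le> (INF i\<in>I. ennreal (f i))"
      by (intro INF_greatest ennreal_leI cINF_lower bdd)
    then show "(INF i\<in>I. f i) \<le> enn2real (INF i\<in>I. ennreal (f i))"
      using fin enn2real_mono[of "ennreal (INF i\<in>I. f i)" "INF i\<in>I. ennreal (f i)"]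
        cINF_greatest[of I 0 f] assms by auto
  qed
qed

lemma wasserstein2_empirical_measure:
  fixes y :: "'a::{metric_space, second_countable_topology}^'m" and z :: "'a^'n"
  shows "(wasserstein2 (empirical_measure y) (empirical_measure z))\<^sup>2 =
    (INF w\<in>uniform_plans. plan_cost w y z)"
proof -
  let ?C = "couplings (empirical_measure y) (empirical_measure z)"
  \<comment> \<open>The two sets of attainable costs coincide, so no optimal coupling has to be
    found to compare the infima.\<close>
  have "(\<lambda>\<pi>. \<integral>\<^sup>+ (a, b). ennreal ((dist a b)\<^sup>2) \<partial>\<pi>) ` ?C =
      (\<lambda>w. ennreal (plan_cost w y z)) ` uniform_plans"
  proof (intro equalityI image_subsetI)
    fix \<pi> assume "\<pi> \<in> ?C"
    then show "(\<integral>\<^sup>+ (a, b). ennreal ((dist a b)\<^sup>2) \<partial>\<pi>) \<in>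
        (\<lambda>w. ennreal (plan_cost w y z)) ` uniform_plans"
      by (rule uniform_plan_of_coupling) simp
  next
    fix w :: "'m \<Rightarrow> 'n \<Rightarrow> real" assume "w \<in> uniform_plans"
    then obtain \<pi> where "\<pi> \<in> ?C"
      "(\<integral>\<^sup>+ (a, b). ennreal ((dist a b)\<^sup>2) \<partial>\<pi>) = ennreal (plan_cost w y z)"
      by (rule coupling_of_uniform_plan)
    then show "ennreal (plan_cost w y z) \<in> (\<lambda>\<pi>. \<integral>\<^sup>+ (a, b). ennreal ((dist a b)\<^sup>2) \<partial>\<pi>) ` ?C"
      by (metis (mono_tags, lifting) image_eqI)
  qed
  then show ?thesis
    unfolding wasserstein2_def
    by (simp add: enn2real_INF_ennreal uniform_plans_nonempty plan_cost_nonneg cINF_greatest)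
qed

section \<open>The integrand over the sphere: measurability and integrability\<close>

lemma distr_empirical_measure:
  fixes Y :: "'a::topological_space^'n" and f :: "'a \<Rightarrow> 'b::topological_space"
  assumes "f \<in> borel_measurable borel"
  shows "distr (empirical_measure Y) borel f = empirical_measure (\<chi> k. f (Y $ k))"
  unfolding empirical_measure_def using assms
  by (subst distr_distr)
    (auto simp: comp_def measurable_def[of "uniform_count_measure _"] space_uniform_count_measure
      sets_uniform_count_measure intro!: arg_cong[where f = "distr _ _"])

text \<open>The integrand of \<open>sliced_energy\<close>: a push-forward of an empirical measure
  just maps its rows, so the squared distance of the projections is this infimum. Allowing every
  \<open>\<theta>\<close>, not only unit vectors, lets measurability be shown on the whole space and
  then restricted to the sphere.\<close>

definition projected_cost :: "real^'d^'n \<Rightarrow> real^'d^'n \<Rightarrow> real^'d \<Rightarrow> real" where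
  "projected_cost Z Y \<theta> =
     (INF w\<in>uniform_plans. plan_cost w (\<chi> k. \<theta> \<bullet> Y $ k) (\<chi> k. \<theta> \<bullet> Z $ k))"

lemma sliced_energy_eq: "sliced_energy Z Y = (\<integral>\<theta>. projected_cost Z Y \<theta> \<partial>uniform_sphere)"
  unfolding sliced_energy_def projected_cost_def
  by (simp add: distr_empirical_measure wasserstein2_empirical_measure)

lemma projected_cost_nonneg: "0 \<le> projected_cost Z Y \<theta>"
  unfolding projected_cost_def
  by (intro cINF_greatest uniform_plans_nonempty plan_cost_nonneg)

lemma projected_cost_le:
  assumes "w \<in> uniform_plans"
  shows "projected_cost Z Y \<theta> \<le> plan_cost w (\<chi> k. \<theta> \<bullet> Y $ k) (\<chi> k. \<theta> \<bullet> Z $ k)"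
  unfolding projected_cost_def by (intro cINF_lower bdd_below_plan_cost assms)

lemma borel_measurable_projected_cost [measurable]: "projected_cost Z Y \<in> borel_measurable borel"
proof (rule borel_measurableI_less)
  txt \<open>An infimum of continuous functions, even of uncountably many, is upper semicontinuous.\<close>
  fix c :: real
  have "{\<theta>. projected_cost Z Y \<theta> < c} =
      (\<Union>w\<in>uniform_plans. {\<theta>. plan_cost w (\<chi> k. \<theta> \<bullet> Y $ k) (\<chi> k. \<theta> \<bullet> Z $ k) < c})"
    unfolding projected_cost_def
    by (auto simp: cINF_less_iff[OF uniform_plans_nonempty bdd_below_plan_cost])
  moreover have "open {\<theta>. plan_cost w (\<chi> k. \<theta> \<bullet> Y $ k) (\<chi> k. \<theta> \<bullet> Z $ k) < c}" for w
    unfolding plan_cost_def by (intro open_Collect_less) (auto intro!: continuous_intros)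
  ultimately have "open {\<theta>. projected_cost Z Y \<theta> < c}" by auto
  then show "{\<theta> \<in> space borel. projected_cost Z Y \<theta> < c} \<in> sets borel" by simp
qed

lemma space_uniform_sphere: "space uniform_sphere = sphere 0 1"
  by (simp add: uniform_sphere_def space_restrict_space)

text \<open>On a probability space a bound suffices. The product plan gives one independent of
  \<open>\<theta>\<close>, since by Cauchy-Schwarz projection onto a unit vector does not increase
  distances.\<close>

lemma integrable_projected_cost:
  fixes Y Z :: "real^'d^'n"
  shows "integrable uniform_sphere (projected_cost Z Y)"
proof -
  interpret prob_space "uniform_sphere :: (real^'d) measure" by (rule prob_space_uniform_sphere)
  define w :: "'n \<Rightarrow> 'n \<Rightarrow> real" where "w = (\<lambda>k l. 1 / (real CARD('n) * real CARD('n)))"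
  have w: "w \<in> uniform_plans" unfolding w_def by (rule const_mem_uniform_plans)
  show ?thesis
  proof (rule integrable_const_bound[where B = "plan_cost w Y Z"])
    show "AE \<theta> in uniform_sphere. norm (projected_cost Z Y \<theta>) \<le> plan_cost w Y Z"
    proof (rule AE_I2)
      fix \<theta> :: "real^'d" assume "\<theta> \<in> space uniform_sphere"
      then have "norm \<theta> = 1" by (simp add: space_uniform_sphere)
      then have "dist (\<theta> \<bullet> u) (\<theta> \<bullet> v) \<le> dist u v" for u v
        using Cauchy_Schwarz_ineq2[of \<theta> "u - v"] by (simp add: dist_norm inner_diff_right)
      then have "plan_cost w (\<chi> k. \<theta> \<bullet> Y $ k) (\<chi> k. \<theta> \<bullet> Z $ k) \<le> plan_cost w Y Z"
        unfolding plan_cost_def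
        by (intro sum_mono mult_left_mono power_mono) (auto simp: w_def)
      then show "norm (projected_cost Z Y \<theta>) \<le> plan_cost w Y Z"
        using projected_cost_le[OF w, of Z Y \<theta>] projected_cost_nonneg[of Z Y \<theta>] by simp
    qed
    show "projected_cost Z Y \<in> borel_measurable uniform_sphere"
      unfolding uniform_sphere_def by (rule measurable_restrict_space1) simp
  qed
qed

section \<open>Convexity defects and semi-concavity\<close>

lemma norm_convex_combination_squared:
  fixes a b :: "'a::real_inner"
  assumes "u + t = 1"
  shows "(norm (u *\<^sub>R a + t *\<^sub>R b))\<^sup>2 = u * (norm a)\<^sup>2 + t * (norm b)\<^sup>2 - u * t * (norm (a - b))\<^sup>2"
proof -
  have u: "u = 1 - t" using assms by simp
  show ?thesis
    unfolding power2_norm_eq_inner u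
    by (simp add: inner_add_left inner_add_right inner_diff_left inner_diff_right inner_commute[of b a])
      algebra
qed

text \<open>Each squared distance has a convexity defect that is unaffected by the translation by
  \<open>z $ l\<close>. As the row sums of \<open>w\<close> are fixed, the weighted total of these
  defects depends on neither \<open>w\<close> nor \<open>z\<close>, so it can be taken out of an
  infimum over plans.\<close>

lemma plan_cost_convex_combination:
  fixes a b :: "'a::real_inner^'m" and z :: "'a^'n"
  assumes w: "w \<in> uniform_plans" and ut: "u + t = 1"
  shows "plan_cost w (u *\<^sub>R a + t *\<^sub>R b) z =
    u * plan_cost w a z + t * plan_cost w b z - u * t * ((norm (a - b))\<^sup>2 / CARD('m))"
proof -
  have dist_eq: "(dist ((u *\<^sub>R a + t *\<^sub>R b) $ k) (z $ l))\<^sup>2 = u * (dist (a $ k) (z $ l))\<^sup>2 +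
      t * (dist (b $ k) (z $ l))\<^sup>2 - u * t * (norm (a $ k - b $ k))\<^sup>2" for k l
  proof -
    have "(u *\<^sub>R a + t *\<^sub>R b) $ k - z $ l = u *\<^sub>R (a $ k - z $ l) + t *\<^sub>R (b $ k - z $ l)"
      using ut by (simp add: algebra_simps) (metis scaleR_add_left scaleR_one)
    then show ?thesis
      using norm_convex_combination_squared[OF ut, of "a $ k - z $ l" "b $ k - z $ l"]
      by (simp add: dist_norm)
  qed
  have "(\<Sum>k\<in>UNIV. \<Sum>l\<in>UNIV. w k l * (norm (a $ k - b $ k))\<^sup>2) = (norm (a - b))\<^sup>2 / CARD('m)"
    using w unfolding uniform_plans_def
    by (simp add: sum_distrib_right[symmetric] sum_divide_distrib[symmetric] norm_vec_def L2_set_def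
        sum_nonneg)
  moreover have "plan_cost w (u *\<^sub>R a + t *\<^sub>R b) z = u * plan_cost w a z + t * plan_cost w b z -
      u * t * (\<Sum>k\<in>UNIV. \<Sum>l\<in>UNIV. w k l * (norm (a $ k - b $ k))\<^sup>2)"
    unfolding plan_cost_def dist_eq
    by (simp add: sum_distrib_left sum.distrib[symmetric] sum_subtractf[symmetric] algebra_simps)
  ultimately show ?thesis by simp
qed

lemma concave_on_projected_cost:
  fixes Z :: "real^'d^'n"
  assumes \<theta>: "norm \<theta> = 1"
  shows "concave_on UNIV (\<lambda>Y. projected_cost Z Y \<theta> - 1 / real CARD('n) * (norm Y)\<^sup>2)"
  unfolding concave_on_iff
proof (intro conjI convex_UNIV ballI allI impI)
  fix A B :: "real^'d^'n" and u t :: real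
  assume u: "0 \<le> u" and t: "0 \<le> t" and ut: "u + t = 1"
  let ?P = "\<lambda>Y :: real^'d^'n. (\<chi> k. \<theta> \<bullet> Y $ k)"
  \<comment> \<open>The defect of the projected cost is governed by the projected rows; this bounds
    it by the defect of the squared Frobenius norm divided by \<open>CARD('n)\<close>.\<close>
  have "norm (?P A - ?P B) \<le> norm (A - B)"
    unfolding norm_vec_def[of "?P A - ?P B"] norm_vec_def[of "A - B"]
  proof (intro L2_set_mono)
    fix k
    show "norm ((?P A - ?P B) $ k) \<le> norm ((A - B) $ k)"
      using Cauchy_Schwarz_ineq2[of \<theta> "A $ k - B $ k"] \<theta> by (simp add: inner_diff_right)
  qed simp
  then have contr: "u * t * ((norm (?P A - ?P B))\<^sup>2 / CARD('n)) \<le> u * t * ((norm (A - B))\<^sup>2 / CARD('n))"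
    using u t by (intro mult_left_mono divide_right_mono power_mono) auto
  have "u * projected_cost Z A \<theta> + t * projected_cost Z B \<theta> - u * t * ((norm (A - B))\<^sup>2 / CARD('n))
      \<le> projected_cost Z (u *\<^sub>R A + t *\<^sub>R B) \<theta>"
    unfolding projected_cost_def[of Z "u *\<^sub>R A + t *\<^sub>R B"]
  proof (rule cINF_greatest[OF uniform_plans_nonempty])
    \<comment> \<open>The plan \<open>w\<close> competes in the infima for both \<open>A\<close> and
      \<open>B\<close>, so its costs bound both values from above.\<close>
    fix w :: "'n \<Rightarrow> 'n \<Rightarrow> real" assume w: "w \<in> uniform_plans"
    have P: "?P (u *\<^sub>R A + t *\<^sub>R B) = u *\<^sub>R ?P A + t *\<^sub>R ?P B"
      by (simp add: vec_eq_iff inner_add_right)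
    show "u * projected_cost Z A \<theta> + t * projected_cost Z B \<theta> - u * t * ((norm (A - B))\<^sup>2 / CARD('n))
      \<le> plan_cost w (?P (u *\<^sub>R A + t *\<^sub>R B)) (?P Z)"
      unfolding P plan_cost_convex_combination[OF w ut]
      using contr mult_left_mono[OF projected_cost_le[OF w, of Z A \<theta>] u]
        mult_left_mono[OF projected_cost_le[OF w, of Z B \<theta>] t] by linarith
  qed
  \<comment> \<open>Expanding the squared norm of the combination yields exactly the defect
    subtracted above, and the two cancel.\<close>
  then show "u * (projected_cost Z A \<theta> - 1 / real CARD('n) * (norm A)\<^sup>2) +
      t * (projected_cost Z B \<theta> - 1 / real CARD('n) * (norm B)\<^sup>2)
      \<le> projected_cost Z (u *\<^sub>R A + t *\<^sub>R B) \<theta> - 1 / real CARD('n) * (norm (u *\<^sub>R A + t *\<^sub>R B))\<^sup>2"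
    unfolding norm_convex_combination_squared[OF ut]
    by (simp add: algebra_simps add_divide_distrib diff_divide_distrib)
qed

theorem proposition2p4:
  fixes Z :: "real^'d^'n"
  shows "concave_on UNIV (\<lambda>Y :: real^'d^'n. sliced_energy Z Y - 1 / real CARD('n) * (norm Y)\<^sup>2)"
proof -
  interpret prob_space "uniform_sphere :: (real^'d) measure" by (rule prob_space_uniform_sphere)
  let ?F = "\<lambda>(Y :: real^'d^'n) \<theta>. projected_cost Z Y \<theta> - 1 / real CARD('n) * (norm Y)\<^sup>2"
  have int: "integrable uniform_sphere (?F Y)" for Y
    by (intro Bochner_Integration.integrable_diff integrable_projected_cost integrable_const)
  \<comment> \<open>The quadratic term moves under the integral because it is constant in
    \<open>\<theta>\<close> and the sphere has mass 1.\<close>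
  have eq: "sliced_energy Z Y - 1 / real CARD('n) * (norm Y)\<^sup>2 = (\<integral>\<theta>. ?F Y \<theta> \<partial>uniform_sphere)" for Y
    unfolding sliced_energy_eq
    by (subst Bochner_Integration.integral_diff[OF integrable_projected_cost integrable_const])
      (simp add: prob_space)
  show ?thesis
    unfolding eq concave_on_iff
  proof (intro conjI convex_UNIV ballI allI impI)
    fix A B :: "real^'d^'n" and u t :: real
    assume ut: "0 \<le> u" "0 \<le> t" "u + t = 1"
    have "u * (\<integral>\<theta>. ?F A \<theta> \<partial>uniform_sphere) + t * (\<integral>\<theta>. ?F B \<theta> \<partial>uniform_sphere) =
        (\<integral>\<theta>. u * ?F A \<theta> + t * ?F B \<theta> \<partial>uniform_sphere)"
      using int by (subst Bochner_Integration.integral_add) auto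
    also have "\<dots> \<le> (\<integral>\<theta>. ?F (u *\<^sub>R A + t *\<^sub>R B) \<theta> \<partial>uniform_sphere)"
    \<comment> \<open>The concavity inequality is needed only on the space of
      \<open>uniform_sphere\<close>, where \<open>norm \<theta> = 1\<close>.\<close>
    proof (rule integral_mono)
      show "integrable uniform_sphere (\<lambda>\<theta>. u * ?F A \<theta> + t * ?F B \<theta>)"
        by (intro Bochner_Integration.integrable_add integrable_mult_right int)
      fix \<theta> :: "real^'d" assume "\<theta> \<in> space uniform_sphere"
      then show "u * ?F A \<theta> + t * ?F B \<theta> \<le> ?F (u *\<^sub>R A + t *\<^sub>R B) \<theta>"
        using concave_on_projected_cost[of \<theta> Z] ut by (simp add: space_uniform_sphere concave_on_iff)
    qed (rule int)
    finally show "u * (\<integral>\<theta>. ?F A \<theta> \<partial>uniform_sphere) + t * (\<integral>\<theta>. ?F B \<theta> \<partial>uniform_sphere)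
        \<le> (\<integral>\<theta>. ?F (u *\<^sub>R A + t *\<^sub>R B) \<theta> \<partial>uniform_sphere)" .
  qed
qed

end
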